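(* Let $s\ge 3$ be even and let $L(x_1,\dots,x_s)=c_1x_1+\dots+c_sx_s$ be a translation-invariant linear form (that is, $c_i\in\mathbb{Z}\setminus\{0\}$ and $c_1+\dots+c_s=0$) that is primitive. If the integer \[ (-1)^{s/2}\prod_{i=1}^s c_i \] is not a perfect square, then \[ r_L(N)=\Omega_L\left(N^{\frac1{s-2}}\right), \] i.e. there is a constant $C>0$ depending only on $L$ such that $r_L(N)\ge C\,N^{1/(s-2)}$ for all integers $N\ge1$.
   Context: A form $L(x_1,\dots,x_s)=\sum_i c_ix_i$ with $c_i\in\mathbb{Z}\setminus\{0\}$, $\sum_i c_i=0$, is primitive if, among the partitions $\mathcal T$ of $[s]=\{1,\dots,s\}$ satisfying $\sum_{i\in T}c_i=0$ for all $T\in\mathcal T$, there is a unique finest one (i.e. a unique one minimal under refinement; equivalently, one that refines all the others). For a solution $(x_1,\dots,x_s)\in\mathbb{Z}^s$ to $L=0$, let $\mathcal T$ be the partition of $[s]$ in which $i,j$ lie in the same block if and only if $x_i=x_j$. The solution is trivial if $\sum_{i\in T}c_i=0$ for all $T\in\mathcal T$, and nontrivial otherwise. A set $A\subseteq\mathbb{Z}$ is $L$-free if all solutions in $A^s$ to $L=0$ are trivial. Define $r_L(N)=\max\{|A| : A\subseteq\{1,\dots,N\} \text{ is } L\text{-free}\}$. *)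

theory Defs
  imports
    Complex_Main
    "HOL-Library.FuncSet"
    "HOL-Library.Disjoint_Sets"
    "HOL-Computational_Algebra.Nth_Powers"
begin

text \<open>
  A linear form \<open>c\<^sub>1 x\<^sub>1 + \<dots> + c\<^sub>s x\<^sub>s\<close> is given by \<open>s\<close> and a coefficient function
  \<open>c :: nat \<Rightarrow> int\<close>, of which only the values on \<open>{1..s}\<close> matter. Likewise a point of
  \<open>\<int>\<^sup>s\<close> is a function \<open>nat \<Rightarrow> int\<close> of which only the values on \<open>{1..s}\<close> matter.
\<close>

definition lin_form :: "nat \<Rightarrow> (nat \<Rightarrow> int) \<Rightarrow> (nat \<Rightarrow> int) \<Rightarrow> int" where
  "lin_form s c x = (\<Sum>i=1..s. c i * x i)"

definition translation_invariant :: "nat \<Rightarrow> (nat \<Rightarrow> int) \<Rightarrow> bool" where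
  "translation_invariant s c \<longleftrightarrow> (\<forall>i\<in>{1..s}. c i \<noteq> 0) \<and> (\<Sum>i=1..s. c i) = 0"

definition zero_sum_blocks :: "(nat \<Rightarrow> int) \<Rightarrow> nat set set \<Rightarrow> bool" where
  "zero_sum_blocks c P \<longleftrightarrow> (\<forall>T\<in>P. (\<Sum>i\<in>T. c i) = 0)"

definition finest_zero_sum_partition ::
    "nat \<Rightarrow> (nat \<Rightarrow> int) \<Rightarrow> nat set set \<Rightarrow> bool" where
  "finest_zero_sum_partition s c P \<longleftrightarrow>
     partition_on {1..s} P \<and> zero_sum_blocks c P \<and>
     (\<forall>Q. partition_on {1..s} Q \<and> zero_sum_blocks c Q \<and> refines {1..s} Q P \<longrightarrow> Q = P)"

definition primitive_form :: "nat \<Rightarrow> (nat \<Rightarrow> int) \<Rightarrow> bool" where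
  "primitive_form s c \<longleftrightarrow> (\<exists>!P. finest_zero_sum_partition s c P)"

definition level_partition :: "nat \<Rightarrow> (nat \<Rightarrow> int) \<Rightarrow> nat set set" where
  "level_partition s x = (\<lambda>i. {j \<in> {1..s}. x j = x i}) ` {1..s}"

definition trivial_solution :: "nat \<Rightarrow> (nat \<Rightarrow> int) \<Rightarrow> (nat \<Rightarrow> int) \<Rightarrow> bool" where
  "trivial_solution s c x \<longleftrightarrow> lin_form s c x = 0 \<and> zero_sum_blocks c (level_partition s x)"

definition form_free :: "nat \<Rightarrow> (nat \<Rightarrow> int) \<Rightarrow> int set \<Rightarrow> bool" where
  "form_free s c A \<longleftrightarrow>
     (\<forall>x \<in> {1..s} \<rightarrow> A. lin_form s c x = 0 \<longrightarrow> trivial_solution s c x)"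

definition r_form :: "nat \<Rightarrow> (nat \<Rightarrow> int) \<Rightarrow> nat \<Rightarrow> nat" where
  "r_form s c N = Max (card ` {A. A \<subseteq> {1..int N} \<and> form_free s c A})"

lemma partition_on_level_partition: "partition_on {1..s} (level_partition s x)"
  by (auto simp: partition_on_def level_partition_def disjoint_def)

text \<open>The maximum in \<open>r_form\<close> is over a finite nonempty set.\<close>

lemma finite_form_free_sets: "finite {A. A \<subseteq> {1..int N} \<and> form_free s c A}"
  by simp

lemma form_free_empty: "form_free s c {}"
  by (cases "s = 0")
    (auto simp: form_free_def trivial_solution_def zero_sum_blocks_def level_partition_def Pi_def)

end

theory Submission
  imports Defs
    "HOL-Number_Theory.Quadratic_Reciprocity"
    "HOL-Computational_Algebra.Squarefree"
    "HOL-Computational_Algebra.Polynomial"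
begin

text \<open>
  Put \<open>D = (-1)\<^bsup>s/2\<^esup> c\<^sub>1 \<cdots> c\<^sub>s\<close> and choose, by quadratic reciprocity, a prime \<open>p > \<Sum>\<bar>c\<^sub>i\<bar>\<close>
  modulo which \<open>D\<close> is not a square. On the moment curve \<open>(t, t\<^sup>2, \<dots>, t\<^bsup>s-2\<^esup>)\<close> over \<open>\<int>/p\<close> the form
  has only trivial zeros: with at most \<open>s - 1\<close> distinct parameters this is the invertibility of a
  Vandermonde matrix, and \<open>s\<close> distinct parameters would make \<open>D\<close> a square modulo \<open>p\<close>.

  To reach every \<open>N\<close> with this single prime, apply the curve to each of the \<open>k\<close> base-\<open>p\<close> digits of
  \<open>t < p\<^sup>k\<close>. A zero of the form is trivial modulo \<open>p\<close> on the lowest digit, so that digit contributes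
  exactly \<open>0\<close>, there is no carry, and the next digit can be treated in the same way. Primitivity
  says that triviality means constancy on the blocks of one fixed partition, so triviality in every
  digit is triviality. Packing the \<open>s - 2\<close> coordinates in base \<open>(1 + \<Sum>\<bar>c\<^sub>i\<bar>) p\<^sup>k\<close> gives a free set of
  \<open>p\<^sup>k\<close> integers in an interval of length \<open>O(p\<^bsup>k(s-2)\<^esup>)\<close>.
\<close>

section \<open>Primes modulo which a given integer is not a square\<close>

lemma Legendre_cong: "[a = b] (mod p) \<Longrightarrow> Legendre a p = Legendre b p"
  by (simp add: Legendre_def QuadRes_def cong_def)

lemma Legendre_values: "Legendre a p \<in> {-1, 0, 1}"
  by (simp add: Legendre_def)

text \<open>Two numbers in \<open>{-1, 0, 1}\<close> differ by at most 2, which is less than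
  \<open>p\<close>. This turns congruences such as Euler's criterion into equalities.\<close>

lemma Legendre_eqI:
  assumes "prime p" "2 < p" "[Legendre a (int p) = e] (mod int p)" "e \<in> {-1, 0, 1}"
  shows "Legendre a (int p) = e"
proof -
  have "int p dvd Legendre a p - e" using assms(3) by (simp add: cong_iff_dvd_diff)
  moreover have "\<bar>Legendre a p - e\<bar> < int p"
    using assms(2,4) Legendre_values[of a "int p"] by auto
  ultimately show ?thesis
    using dvd_imp_le_int[of "Legendre a p - e" "int p"] by fastforce
qed

lemma Legendre_mult:
  assumes "prime p" "2 < p"
  shows "Legendre (a * b) (int p) = Legendre a (int p) * Legendre b (int p)"
proof (rule Legendre_eqI[OF assms])
  have "[Legendre (a * b) p = a ^ ((p - 1) div 2) * b ^ ((p - 1) div 2)] (mod p)"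
    using euler_criterion[OF assms, of "a * b"] by (simp add: power_mult_distrib)
  also have "[a ^ ((p - 1) div 2) * b ^ ((p - 1) div 2) = Legendre a p * Legendre b p] (mod p)"
    by (intro cong_mult cong_sym[OF euler_criterion[OF assms]])
  finally show "[Legendre (a * b) (int p) = Legendre a (int p) * Legendre b (int p)] (mod int p)" .
  show "Legendre a (int p) * Legendre b (int p) \<in> {-1, 0, 1}"
    using Legendre_values[of a "int p"] Legendre_values[of b "int p"] by auto
qed

lemma Legendre_one: "\<not> p dvd 1 \<Longrightarrow> Legendre 1 p = 1"
  by (auto simp: Legendre_def QuadRes_def cong_0_iff intro: exI[of _ 1])

lemma Legendre_prod:
  assumes "prime p" "2 < p" "finite A"
  shows "Legendre (\<Prod>x\<in>A. f x) (int p) = (\<Prod>x\<in>A. Legendre (f x) (int p))"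
  using assms(3)
proof induction
  case empty
  show ?case using assms by (simp add: Legendre_one)
next
  case (insert x F)
  then show ?case by (simp add: Legendre_mult[OF assms(1,2)])
qed

lemma Legendre_square:
  assumes "prime p" "\<not> int p dvd a"
  shows "Legendre (a\<^sup>2) (int p) = 1"
  using assms by (auto simp: Legendre_def QuadRes_def cong_0_iff prime_dvd_power_iff intro: cong_refl)

lemma Legendre_minus_one:
  assumes "prime p" "2 < p"
  shows "Legendre (-1) (int p) = (if p mod 4 = 1 then 1 else -1)"
proof (rule Legendre_eqI[OF assms])
  have "odd p" using assms prime_odd_nat by auto
  then have "even ((p - 1) div 2) \<longleftrightarrow> p mod 4 = 1" by presburger
  then show "[Legendre (-1) (int p) = (if p mod 4 = 1 then 1 else -1)] (mod int p)"
    using euler_criterion[OF assms, of "-1"] by (auto simp: uminus_power_if)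
qed auto

lemma Legendre_two:
  assumes "prime p" "2 < p"
  shows "Legendre 2 (int p) = (if p mod 8 \<in> {1, 7} then 1 else -1)"
proof -
  have "odd p" using assms prime_odd_nat by auto
  interpret GAUSS p 2
    using assms by unfold_locales (auto simp: cong_0_iff zdvd_not_zless)
  define h where "h = (int p - 1) div 2"
  have h: "int p = 2 * h + 1" using p_eq2 by (simp add: h_def)
  \<comment> \<open>For Gauss's lemma: \<open>2 * x\<close> stays below \<open>p\<close> for
    \<open>x \<le> h\<close>, so no reduction takes place and \<open>E\<close> consists of the
    doubles that exceed \<open>h\<close>. Its cardinality has a parity that depends only on
    \<open>p mod 8\<close>.\<close>
  have "E = (\<lambda>x. 2 * x) ` {h div 2 <.. h}"
  proof (intro equalityI subsetI)
    fix y assume "y \<in> E"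
    then obtain x where x: "y = (x * 2) mod int p" "0 < x" "x \<le> h" "h < y"
      by (auto simp: E_def C_def B_def A_def h_def)
    then have "y = 2 * x" using h by (simp add: mod_pos_pos_trivial)
    moreover have "x \<in> {h div 2 <.. h}" using x(3,4) \<open>y = 2 * x\<close> by auto
    ultimately show "y \<in> (\<lambda>x. 2 * x) ` {h div 2 <.. h}" by blast
  next
    fix y assume "y \<in> (\<lambda>x. 2 * x) ` {h div 2 <.. h}"
    then obtain x where x: "y = 2 * x" "h div 2 < x" "x \<le> h" by auto
    have "0 \<le> h" using h assms by auto
    then have "0 < x" using x by linarith
    then have "y = (x * 2) mod int p" using h x by (simp add: mod_pos_pos_trivial)
    moreover have "h < y" using x by linarith
    moreover have "x \<in> A" using x(3) \<open>0 < x\<close> by (simp add: A_def h_def)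
    ultimately show "y \<in> E" by (auto simp: E_def C_def B_def h_def)
  qed
  then have "card E = nat (h - h div 2)"
    by (simp add: card_image inj_on_def)
  moreover have "even (nat (h - h div 2)) \<longleftrightarrow> p mod 8 \<in> {1, 7}"
  proof -
    have "0 \<le> h" using h assms by auto
    then obtain m where m: "h = int m" using nonneg_int_cases by blast
    then have p: "p = 2 * m + 1" using h by linarith
    have "nat (h - h div 2) = m - m div 2" unfolding m by linarith
    moreover have "even (m - m div 2) \<longleftrightarrow> p mod 8 = 1 \<or> p mod 8 = 7" unfolding p by presburger
    ultimately show ?thesis by simp
  qed
  ultimately show ?thesis using gauss_lemma by auto
qed

lemma Legendre_reciprocity:
  assumes "prime p" "2 < p" "prime q" "2 < q" "p \<noteq> q"
  shows "Legendre (int q) (int p) =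
    Legendre (int p) (int q) * (if q mod 4 = 3 \<and> p mod 4 = 3 then -1 else 1)"
proof -
  have "odd p" "odd q" using assms prime_odd_nat by auto
  then have "odd ((p - 1) div 2 * ((q - 1) div 2)) \<longleftrightarrow> q mod 4 = 3 \<and> p mod 4 = 3"
    unfolding even_mult_iff by presburger
  then have e: "Legendre (int p) (int q) * Legendre (int q) (int p) =
      (if q mod 4 = 3 \<and> p mod 4 = 3 then -1 else 1)"
    using Quadratic_Reciprocity[OF assms] by (auto simp: uminus_power_if)
  then show ?thesis
    using Legendre_values[of p q] Legendre_values[of q p] by (auto split: if_splits)
qed

section \<open>A symbol multiplicative in the modulus\<close>

lemma odd_prime_int_nat:
  fixes a :: int
  assumes "prime a" "a \<noteq> 2"
  shows "prime (nat a)" "2 < nat a" "int (nat a) = a"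
proof -
  obtain n where n: "a = int n" using prime_ge_0_int[OF assms(1)] nonneg_int_cases by blast
  then have "prime n" using assms by simp
  then show "prime (nat a)" "2 < nat a" "int (nat a) = a"
    using n assms(2) prime_ge_2_nat[of n] by (auto simp: le_less)
qed

text \<open>The reciprocity laws express the Legendre symbol of \<open>a\<close> modulo a prime \<open>n\<close> by this function,
  which is multiplicative on all odd \<open>n\<close> and thus plays the role of the Jacobi symbol.\<close>

definition recip_symbol :: "int \<Rightarrow> nat \<Rightarrow> int" where
  "recip_symbol a n =
    (if a = -1 then (if n mod 4 = 1 then 1 else -1)
     else if a = 2 then (if n mod 8 \<in> {1, 7} then 1 else -1)
     else Legendre (int n) a * (if a mod 4 = 3 \<and> n mod 4 = 3 then -1 else 1))"

text \<open>On odd numbers the signs are characters modulo 4 or 8, which is a finite check on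
  residues. For an odd prime \<open>a\<close> the other factor is the Legendre symbol modulo the
  fixed prime \<open>a\<close>, multiplicative in its numerator.\<close>

lemma recip_symbol_mult:
  assumes "a = -1 \<or> prime a" "odd m" "odd n"
  shows "recip_symbol a (m * n) = recip_symbol a m * recip_symbol a n"
proof -
  have m4: "m mod 4 = 1 \<or> m mod 4 = 3" "n mod 4 = 1 \<or> n mod 4 = 3" using assms(2,3) by presburger+
  have mn4: "(m * n) mod 4 = ((m mod 4) * (n mod 4)) mod 4" by (simp add: mod_mult_eq)
  have m8: "m mod 8 \<in> {1,3,5,7}" "n mod 8 \<in> {1,3,5,7}" using assms(2,3) unfolding insert_iff empty_iff by presburger+
  have mn8: "(m * n) mod 8 = ((m mod 8) * (n mod 8)) mod 8" by (simp add: mod_mult_eq)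
  consider "a = -1" | "a = 2" | "a \<noteq> -1" "a \<noteq> 2" "prime a" using assms by auto
  then show ?thesis
  proof cases
    case 1
    then show ?thesis unfolding recip_symbol_def mn4 using m4 by auto
  next
    case 2
    then show ?thesis unfolding recip_symbol_def mn8 using m8 by auto
  next
    case 3
    have "prime (nat a)" "2 < nat a" "int (nat a) = a"
      using odd_prime_int_nat 3 by blast+
    then have "Legendre (int m * int n) a = Legendre (int m) a * Legendre (int n) a"
      using Legendre_mult[of "nat a" "int m" "int n"] by simp
    then show ?thesis using 3 m4 unfolding recip_symbol_def mn4 by auto
  qed
qed

lemma Legendre_eq_recip_symbol:
  assumes "a = -1 \<or> prime a" "prime p" "2 < p" "int p \<noteq> a"
  shows "Legendre a (int p) = recip_symbol a p"
proof -
  consider "a = -1" | "a = 2" | "a \<noteq> -1" "a \<noteq> 2" "prime a" using assms by auto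
  then show ?thesis
  proof cases
    case 1
    then show ?thesis using Legendre_minus_one[OF assms(2,3)] by (simp add: recip_symbol_def)
  next
    case 2
    then show ?thesis using Legendre_two[OF assms(2,3)] by (simp add: recip_symbol_def)
  next
    case 3
    have q: "prime (nat a)" "2 < nat a" "int (nat a) = a"
      using odd_prime_int_nat 3 by blast+
    moreover have "int (nat a mod 4) = a mod 4" using q(3) by (simp add: zmod_int)
    then have "nat a mod 4 = 3 \<longleftrightarrow> a mod 4 = 3" by auto
    ultimately show ?thesis
      using Legendre_reciprocity[OF assms(2,3) q(1,2)] assms(4) 3
      by (auto simp: recip_symbol_def)
  qed
qed

text \<open>Squaring on the residues modulo \<open>p\<close> identifies 1 and \<open>p - 1\<close>,
  so on a finite set it cannot be onto.\<close>

lemma exists_quadratic_nonresidue: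
  assumes "prime p" "2 < p"
  obtains r where "Legendre r (int p) = -1"
proof -
  let ?A = "{0..<int p}" let ?f = "\<lambda>x. x\<^sup>2 mod int p"
  have "\<not> inj_on ?f ?A"
  proof
    assume "inj_on ?f ?A"
    moreover have "?f 1 = ?f (int p - 1)"
    proof -
      have "(int p - 1)\<^sup>2 = 1 + (int p - 2) * int p" by (simp add: power2_eq_square algebra_simps)
      then show ?thesis by simp
    qed
    moreover have "1 \<in> ?A" "int p - 1 \<in> ?A" using assms(2) by auto
    ultimately have "1 = int p - 1" by (metis (no_types, lifting) inj_onD)
    then show False using assms by simp
  qed
  then have "?f ` ?A \<noteq> ?A" using eq_card_imp_inj_on[of ?A ?f] by auto
  moreover have "?f ` ?A \<subseteq> ?A" using assms by auto
  ultimately obtain r where r: "r \<in> ?A" "r \<notin> ?f ` ?A" by blast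
  have "\<not> QuadRes (int p) r"
  proof
    assume "QuadRes (int p) r"
    then obtain y where "[y\<^sup>2 = r] (mod int p)" by (auto simp: QuadRes_def)
    then have "(y mod int p)\<^sup>2 mod int p = r" using r(1) by (simp add: cong_def power_mod)
    moreover have "y mod int p \<in> ?A" using assms by simp
    ultimately show False using r(2) by blast
  qed
  moreover have "\<not> [r = 0] (mod int p)"
    using \<open>\<not> QuadRes (int p) r\<close> unfolding QuadRes_def by (metis cong_sym zero_power2)
  ultimately have "Legendre r (int p) = -1" by (simp add: Legendre_def)
  then show ?thesis by (rule that)
qed


section \<open>An odd modulus with symbol product -1, and a suitable prime factor of it\<close>

lemma recip_symbol_eq_1:
  assumes "[n = 1] (mod 8)" "a = -1 \<or> prime a" "a \<noteq> -1 \<Longrightarrow> a \<noteq> 2 \<Longrightarrow> [int n = 1] (mod a)"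
  shows "recip_symbol a n = 1"
proof -
  have "n mod 8 = 1" using assms(1) by (simp add: cong_def)
  moreover from this have "n mod 4 = 1" by presburger
  moreover have "Legendre (int n) a = 1" if "a \<noteq> -1" "a \<noteq> 2"
    using Legendre_cong[OF assms(3)[OF that]] that assms(2) Legendre_one[of a] by auto
  ultimately show ?thesis by (auto simp: recip_symbol_def)
qed

lemma cong_one_of_cong_prod:
  fixes n p :: nat
  assumes "[n = 1] (mod \<Prod>P)" "finite P" "p \<in> P"
  shows "[n = 1] (mod p)"
  using assms(1) cong_dvd_modulus_nat dvd_prodI[OF assms(2,3), of "\<lambda>x. x"] by blast

text \<open>By the Chinese remainder theorem \<open>n\<close> is chosen so that the symbols multiply
  to -1: if \<open>S\<close> contains an odd prime \<open>q\<close>, then \<open>n\<close> is a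
  nonresidue modulo \<open>q\<close> and all other symbols are 1; otherwise \<open>S\<close> lies in
  \<open>{-1, 2}\<close> and a residue modulo 8 decides. Being 1 modulo the small odd primes (other
  than \<open>q\<close>) keeps the prime factors of \<open>n\<close> large.\<close>

lemma exists_recip_symbol_eq_minus_one:
  assumes S: "finite S" "S \<noteq> {}" "\<And>a. a \<in> S \<Longrightarrow> a = -1 \<or> prime a"
  obtains n where "odd n" "\<And>p. prime p \<Longrightarrow> p dvd n \<Longrightarrow> p > M" "(\<Prod>a\<in>S. recip_symbol a n) = -1"
proof (cases "\<exists>q\<in>S. q \<noteq> -1 \<and> q \<noteq> 2")
  case True
  then obtain q where q: "q \<in> S" "q \<noteq> -1" "q \<noteq> 2" by blast
  then have pq: "prime q" using S by auto
  define q' where "q' = nat q"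
  have q': "prime q'" "2 < q'" "int q' = q"
    unfolding q'_def using odd_prime_int_nat[OF pq q(3)] by blast+
  \<comment> \<open>Bounding the elements of \<open>S\<close> as well puts every odd prime of
    \<open>S\<close> except \<open>q\<close> into \<open>P\<close>, where \<open>n\<close> is 1 and
    the symbol is trivial.\<close>
  define M' where "M' = Max (insert M (nat ` S))"
  have M': "M \<le> M'" "\<And>a. a \<in> S \<Longrightarrow> nat a \<le> M'" using S(1) by (auto simp: M'_def)
  define P where "P = {p. prime p \<and> p \<le> M' \<and> p \<noteq> q' \<and> p \<noteq> 2}"
  have finP: "finite P" by (auto simp: P_def)
  have "coprime (8 * \<Prod>P) q'"
  proof -
    have "coprime (\<Prod>P) q'"
      by (rule prod_coprime_left) (use q'(1) in \<open>auto simp: P_def intro: primes_coprime\<close>)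
    moreover have "coprime (8::nat) q'"
      using primes_coprime[of 2 q'] q' coprime_power_left_iff[of 2 3 q'] by (simp add: two_is_prime_nat)
    ultimately show ?thesis by simp
  qed
  obtain r where r: "Legendre r (int q') = -1" using exists_quadratic_nonresidue[OF q'(1,2)] .
  obtain n where n: "[n = 1] (mod 8 * \<Prod>P)" "[n = nat (r mod q)] (mod q')"
    using binary_chinese_remainder_nat[OF \<open>coprime (8 * \<Prod>P) q'\<close>] by blast
  have n8: "[n = 1] (mod 8)" using n(1) cong_modulus_mult_nat by blast
  have nP: "[n = 1] (mod \<Prod>P)" using n(1) cong_modulus_mult_nat[of n 1 "\<Prod>P" 8] by (simp add: mult.commute)
  have "[int n = int (nat (r mod q))] (mod q)" using n(2) q'(3) cong_int_iff by metis
  then have "[int n = r] (mod q)" using q' by (simp add: cong_def)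
  then have Lq: "Legendre (int n) q = -1" using Legendre_cong r q'(3) by metis
  show ?thesis
  proof
    show odd: "odd n" using n8 by (auto simp: cong_def) presburger
    show "p > M" if "prime p" "p dvd n" for p
    proof (rule ccontr)
      assume "\<not> p > M"
      \<comment> \<open>\<open>P\<close> omits \<open>q'\<close>, but divisibility by
        \<open>q'\<close> would make the symbol 0 instead of -1.\<close>
      have "p \<noteq> q'" using Lq that(2) q'(3) by (auto simp: Legendre_def cong_0_iff split: if_splits)
      moreover have "p \<noteq> 2" using odd that by auto
      ultimately have "p \<in> P" using \<open>\<not> p > M\<close> M'(1) that by (auto simp: P_def)
      then have "[n = 1] (mod p)" using cong_one_of_cong_prod[OF nP finP] by blast
      then show False using that by (metis cong_dvd_iff nat_dvd_1_iff_1 not_prime_1)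
    qed
    have "(\<Prod>a\<in>S. recip_symbol a n) = recip_symbol q n * (\<Prod>a\<in>S - {q}. recip_symbol a n)"
      using S(1) q(1) by (simp add: prod.remove)
    also have "(\<Prod>a\<in>S - {q}. recip_symbol a n) = 1"
    proof (intro prod.neutral ballI recip_symbol_eq_1[OF n8])
      fix a assume a: "a \<in> S - {q}"
      then show "a = -1 \<or> prime a" using S(3) by auto
      assume "a \<noteq> -1" "a \<noteq> 2"
      then have pa: "prime a" using a S(3) by auto
      have "nat a \<in> P"
        using a M'(2)[of a] q'(3) odd_prime_int_nat[OF pa \<open>a \<noteq> 2\<close>] by (auto simp: P_def)
      then have "[int n = int 1] (mod int (nat a))"
        using cong_one_of_cong_prod[OF nP finP] cong_int_iff by blast
      then show "[int n = 1] (mod a)" using prime_ge_2_int[OF pa] by simp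
    qed
    also have "recip_symbol q n = -1"
    proof -
      have "n mod 8 = 1" using n8 by (simp add: cong_def)
      then have "n mod 4 = 1" by presburger
      then show ?thesis using q Lq by (simp add: recip_symbol_def)
    qed
    finally show "(\<Prod>a\<in>S. recip_symbol a n) = -1" by simp
  qed
next
  case False
  \<comment> \<open>The residue 5 gives symbol 1 at -1 and -1 at 2, which serves \<open>{2}\<close>
    and \<open>{-1, 2}\<close>; the residue 3 gives -1 at -1, which serves
    \<open>{-1}\<close>.\<close>
  define r where "r = (if 2 \<in> S then 5 else 3 :: nat)"
  define P where "P = {p. prime p \<and> p \<le> M \<and> p \<noteq> 2}"
  have finP: "finite P" by (auto simp: P_def)
  have "coprime (2::nat) (\<Prod>P)"
    by (rule prod_coprime_right) (use primes_dvd_imp_eq[OF two_is_prime_nat] in \<open>auto simp: P_def\<close>)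
  then have "coprime (8::nat) (\<Prod>P)" using coprime_power_left_iff[of 2 3 "\<Prod>P"] by simp
  then obtain n where n: "[n = r] (mod 8)" "[n = 1] (mod \<Prod>P)"
    using binary_chinese_remainder_nat by blast
  have n8: "n mod 8 = r" using n(1) by (auto simp: cong_def r_def)
  show ?thesis
  proof
    show odd: "odd n" using n8 by (auto simp: r_def split: if_splits) presburger+
    show "p > M" if "prime p" "p dvd n" for p
    proof (rule ccontr)
      assume "\<not> p > M"
      moreover have "p \<noteq> 2" using odd that by auto
      ultimately have "p \<in> P" using that by (auto simp: P_def)
      then have "[n = 1] (mod p)" using cong_one_of_cong_prod[OF n(2) finP] by blast
      then show False using that by (metis cong_dvd_iff nat_dvd_1_iff_1 not_prime_1)
    qed
    have "S \<in> Pow {-1, 2}" using False by auto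
    then have "S = {-1} \<or> S = {2} \<or> S = {-1, 2}" using S(2) by (auto simp: Pow_insert)
    moreover have "n mod 8 = 5 \<Longrightarrow> n mod 4 = 1" "n mod 8 = 3 \<Longrightarrow> n mod 4 = 3" by presburger+
    ultimately show "(\<Prod>a\<in>S. recip_symbol a n) = -1"
      using n8 by (auto simp: r_def recip_symbol_def)
  qed
qed

text \<open>Used contrapositively: if the product at \<open>n\<close> is -1, some prime factor of
  \<open>n\<close> already has product different from 1. Prime factors are split off one at a time
  by multiplicativity.\<close>

lemma recip_symbol_prod_eq_1:
  assumes "finite S" "\<And>a. a \<in> S \<Longrightarrow> a = -1 \<or> prime a" "odd n"
    and "\<And>p. prime p \<Longrightarrow> p dvd n \<Longrightarrow> (\<Prod>a\<in>S. recip_symbol a p) = 1"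
  shows "(\<Prod>a\<in>S. recip_symbol a n) = 1"
  using assms(3,4)
proof (induction n rule: less_induct)
  case (less n)
  show ?case
  proof (cases "n = 1")
    case True
    have "recip_symbol a 1 = 1" if "a \<in> S" for a
      using assms(2)[OF that] by (intro recip_symbol_eq_1) auto
    then show ?thesis using True by simp
  next
    case False
    then obtain p where p: "prime p" "p dvd n" using prime_factor_nat by blast
    then obtain m where m: "n = p * m" by auto
    then have odds: "odd p" "odd m" using less.prems(1) by auto
    have "m < n" using m p prime_gt_1_nat[of p] odds by (cases "m = 0") auto
    then have "(\<Prod>a\<in>S. recip_symbol a m) = 1"
      using less.IH[of m] odds less.prems(2) m by auto
    moreover have "(\<Prod>a\<in>S. recip_symbol a n) =
        (\<Prod>a\<in>S. recip_symbol a p) * (\<Prod>a\<in>S. recip_symbol a m)"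
      unfolding m using recip_symbol_mult[OF assms(2) odds] by (simp add: prod.distrib)
    ultimately show ?thesis using less.prems(2)[OF p] by simp
  qed
qed

lemma squarefree_int_prod_signed_primes:
  fixes u :: int
  assumes "squarefree u"
  obtains S where "finite S" "\<And>a. a \<in> S \<Longrightarrow> a = -1 \<or> prime a" "u = \<Prod>S"
proof -
  have u0: "u \<noteq> 0" using assms by auto
  have "\<bar>u\<bar> = (\<Prod>p\<in>prime_factors u. p ^ multiplicity p u)"
    using prod_prime_factors[OF u0] by simp
  also have "\<dots> = \<Prod>(prime_factors u)"
  proof (rule prod.cong)
    fix p assume "p \<in> prime_factors u"
    then show "p ^ multiplicity p u = p"
      using assms u0 squarefree_factorial_semiring''[OF u0]
      by (auto simp: prime_factors_multiplicity le_Suc_eq)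
  qed simp
  finally have abs: "\<bar>u\<bar> = \<Prod>(prime_factors u)" .
  have notin: "-1 \<notin> prime_factors u" using prime_ge_0_int[of "-1"] by (auto dest: in_prime_factors_imp_prime)
  show ?thesis
  proof (cases "u > 0")
    case True
    show ?thesis by (rule that[of "prime_factors u"]) (use abs True in auto)
  next
    case False
    show ?thesis by (rule that[of "insert (-1) (prime_factors u)"]) (use abs False notin in auto)
  qed
qed

theorem exists_prime_nonresidue:
  fixes D :: int
  assumes "\<not> is_square D"
  obtains p where "prime p" "p > M" "Legendre D (int p) = -1"
proof -
  define m where "m = square_part D"
  have D0: "D \<noteq> 0" using assms is_nth_power_0[of 2] by (metis zero_less_numeral)
  obtain S where S: "finite S" "\<And>a. a \<in> S \<Longrightarrow> a = -1 \<or> prime a" "squarefree_part D = \<Prod>S"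
    using squarefree_int_prod_signed_primes[OF squarefree_squarefree_part[of D]] by blast
  have D: "D = \<Prod>S * m\<^sup>2" using squarefree_decompose[of D] S(3) by (simp add: m_def)
  then have "S \<noteq> {}" using assms by auto
  \<comment> \<open>A prime beyond this bound exceeds both \<open>M\<close> and 2, does not divide
    \<open>m\<close>, and differs from every element of \<open>S\<close>, so that symbols and
    Legendre symbols agree there and \<open>D\<close> is not divisible by it.\<close>
  define M' where "M' = Max (insert (M + 2) (insert (nat \<bar>m\<bar>) (nat ` S)))"
  have M': "M + 2 \<le> M'" "nat \<bar>m\<bar> \<le> M'" "\<And>a. a \<in> S \<Longrightarrow> nat a \<le> M'"
    unfolding M'_def using S(1) by (intro Max_ge; simp)+
  obtain n where n: "odd n" "\<And>p. prime p \<Longrightarrow> p dvd n \<Longrightarrow> p > M'" "(\<Prod>a\<in>S. recip_symbol a n) = -1"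
    using exists_recip_symbol_eq_minus_one[OF S(1) \<open>S \<noteq> {}\<close> S(2)] by blast
  then obtain p where p: "prime p" "p dvd n" "(\<Prod>a\<in>S. recip_symbol a p) \<noteq> 1"
    using recip_symbol_prod_eq_1[OF S(1,2) n(1)] by fastforce
  have pM: "p > M'" using n(2) p by blast
  have p2: "2 < p" using pM M' by auto
  have "m \<noteq> 0" using D0 D by auto
  then have "\<not> int p dvd m" using pM M'(2) dvd_imp_le_int[of m "int p"] by auto
  have "Legendre D (int p) = Legendre (\<Prod>S) (int p)"
    using Legendre_square[OF p(1) \<open>\<not> int p dvd m\<close>] by (simp add: D Legendre_mult[OF p(1) p2])
  also have "\<dots> = (\<Prod>a\<in>S. Legendre a (int p))" by (rule Legendre_prod[OF p(1) p2 S(1)])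
  also have "\<dots> = (\<Prod>a\<in>S. recip_symbol a p)"
    using pM M'(3) by (intro prod.cong refl Legendre_eq_recip_symbol S(2) p(1) p2) fastforce+
  finally have L: "Legendre D (int p) = (\<Prod>a\<in>S. recip_symbol a p)" .
  have "\<not> int p dvd \<Prod>S"
  proof
    assume "int p dvd \<Prod>S"
    then obtain a where a: "a \<in> S" "int p dvd a"
      using prime_dvd_prod_iff[OF S(1), of "int p" "\<lambda>x. x"] p(1) by auto
    moreover have "a \<noteq> 0" using S(2)[OF a(1)] by auto
    ultimately have "int p \<le> \<bar>a\<bar>" using dvd_imp_le_int[of a "int p"] by simp
    then show False using S(2)[OF a(1)] M'(3)[OF a(1)] pM p2 prime_ge_2_int[of a] by auto
  qed
  then have "\<not> int p dvd D" using \<open>\<not> int p dvd m\<close> p(1)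
    by (simp add: D prime_dvd_mult_iff prime_dvd_power_iff)
  then have "Legendre D (int p) = -1" using L p(3) by (auto simp: Legendre_def cong_0_iff split: if_splits)
  then show ?thesis using that p(1) pM M'(1) by force
qed

section \<open>Zeros on the moment curve\<close>

text \<open>Moment conditions may be tested against any polynomial of degree at most
  \<open>d\<close>; well-chosen test polynomials take the place of inverting a Vandermonde
  matrix.\<close>

lemma dvd_sum_poly:
  fixes t c :: "'a \<Rightarrow> int"
  assumes "\<And>j. j \<le> d \<Longrightarrow> p dvd (\<Sum>i\<in>I. c i * t i ^ j)" "degree f \<le> d"
  shows "p dvd (\<Sum>i\<in>I. c i * poly f (t i))"
proof -
  have "(\<Sum>i\<in>I. c i * poly f (t i)) = (\<Sum>i\<in>I. \<Sum>j\<le>degree f. coeff f j * (c i * t i ^ j))"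
    by (simp add: poly_altdef sum_distrib_left algebra_simps)
  also have "\<dots> = (\<Sum>j\<le>degree f. coeff f j * (\<Sum>i\<in>I. c i * t i ^ j))"
    by (subst sum.swap) (simp add: sum_distrib_left)
  also have "p dvd \<dots>"
    using assms by (intro dvd_sum[of "{..degree f}"] dvd_mult) auto
  finally show ?thesis .
qed

lemma degree_prod_linear_le:
  "finite W \<Longrightarrow> degree (\<Prod>w\<in>W. [:- w, 1 :: int:]) \<le> card W"
  using degree_prod_sum_le[of W "\<lambda>w. [:- w, 1 :: int:]"] by simp

text \<open>The test polynomial has the values other than \<open>v\<close> as its roots. It leaves
  only the level sum at \<open>v\<close> times a factor prime to \<open>p\<close>, since distinct
  values are incongruent.\<close>

lemma dvd_level_sum_of_few_values:
  fixes t c :: "'a \<Rightarrow> int"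
  assumes "prime p" "finite I"
    and inj: "\<And>i k. i \<in> I \<Longrightarrow> k \<in> I \<Longrightarrow> p dvd t i - t k \<Longrightarrow> t i = t k"
    and mom: "\<And>j. j \<le> d \<Longrightarrow> p dvd (\<Sum>i\<in>I. c i * t i ^ j)"
    and "card (t ` I) \<le> Suc d"
  shows "p dvd (\<Sum>i\<in>{i\<in>I. t i = v}. c i)"
proof (cases "v \<in> t ` I")
  case False
  then have "{i\<in>I. t i = v} = {}" by auto
  then show ?thesis by (metis dvd_0_right sum.empty)
next
  case True
  define W where "W = t ` I - {v}"
  define f where "f = (\<Prod>w\<in>W. [:- w, 1:])"
  have fin: "finite W" using assms(2) by (simp add: W_def)
  have "card W \<le> d" using True assms(2,5) by (simp add: W_def)
  then have "degree f \<le> d" using degree_prod_linear_le[OF fin] by (simp add: f_def)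
  then have "p dvd (\<Sum>i\<in>I. c i * poly f (t i))" using dvd_sum_poly mom by blast
  also have "(\<Sum>i\<in>I. c i * poly f (t i)) = (\<Sum>i\<in>{i\<in>I. t i = v}. c i * poly f (t i))"
    using fin by (intro sum.mono_neutral_right assms(2)) (auto simp: f_def W_def poly_prod)
  also have "\<dots> = (\<Sum>i\<in>{i\<in>I. t i = v}. c i) * poly f v" by (simp add: sum_distrib_right)
  finally have "p dvd (\<Sum>i\<in>{i\<in>I. t i = v}. c i) * poly f v" .
  moreover have "\<not> p dvd poly f v"
  proof
    assume "p dvd poly f v"
    then obtain w where "w \<in> W" "p dvd v - w"
      using fin assms(1) by (auto simp: f_def poly_prod prime_dvd_prod_iff)
    moreover from this obtain i k where "i \<in> I" "k \<in> I" "v = t i" "w = t k" using True by (auto simp: W_def)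
    ultimately show False using inj[of i k] by (auto simp: W_def)
  qed
  ultimately show ?thesis using assms(1) by (simp add: prime_dvd_mult_iff)
qed

text \<open>The test polynomial vanishes at all points except \<open>t i\<close> and
  \<open>t k\<close>. Multiplying the two remaining terms by \<open>t i - t k\<close> completes both
  products, with opposite signs.\<close>

lemma dvd_diff_of_distinct_values:
  fixes t c :: "'a \<Rightarrow> int"
  assumes "finite I" "inj_on t I" "card I \<le> d + 2"
    and mom: "\<And>j. j \<le> d \<Longrightarrow> p dvd (\<Sum>i\<in>I. c i * t i ^ j)"
    and ik: "i \<in> I" "k \<in> I"
  shows "p dvd c i * (\<Prod>j\<in>I - {i}. t i - t j) - c k * (\<Prod>j\<in>I - {k}. t k - t j)"
proof (cases "i = k")
  case False
  define W where "W = I - {i, k}"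
  define f where "f = (\<Prod>j\<in>W. [:- t j, 1:])"
  have fin: "finite W" using assms(1) by (simp add: W_def)
  have "card W \<le> d" using ik False assms(1,3) by (simp add: W_def card_Diff_subset)
  moreover have "degree f \<le> card W"
    using degree_prod_sum_le[OF fin, of "\<lambda>j. [:- t j, 1:]"] by (simp add: f_def)
  ultimately have "p dvd (\<Sum>i\<in>I. c i * poly f (t i))" using mom by (intro dvd_sum_poly[of d]) auto
  also have "(\<Sum>i\<in>I. c i * poly f (t i)) = (\<Sum>i\<in>{i, k}. c i * poly f (t i))"
    using fin ik by (intro sum.mono_neutral_right assms(1)) (auto simp: f_def W_def poly_prod)
  also have "\<dots> = c i * poly f (t i) + c k * poly f (t k)" using False by simp
  finally have "p dvd (c i * poly f (t i) + c k * poly f (t k)) * (t i - t k)" by simp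
  moreover have "(\<Prod>j\<in>I - {i}. t i - t j) = (t i - t k) * poly f (t i)"
  proof -
    have "I - {i} = insert k W" using ik False by (auto simp: W_def)
    moreover have "k \<notin> W" by (simp add: W_def)
    ultimately show ?thesis using fin by (simp add: f_def poly_prod)
  qed
  moreover have "(\<Prod>j\<in>I - {k}. t k - t j) = (t k - t i) * poly f (t k)"
  proof -
    have "I - {k} = insert i W" using ik False by (auto simp: W_def)
    moreover have "i \<notin> W" by (simp add: W_def)
    ultimately show ?thesis using fin by (simp add: f_def poly_prod)
  qed
  moreover have "c i * ((t i - t k) * poly f (t i)) - c k * ((t k - t i) * poly f (t k)) =
      (c i * poly f (t i) + c k * poly f (t k)) * (t i - t k)"
    by (simp add: algebra_simps)
  ultimately show ?thesis by metis
qed simp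

text \<open>\<open>V\<close> is a Vandermonde determinant up to sign: each unordered pair occurs in
  both orders and contributes minus a square.\<close>

lemma prod_differences_eq_square:
  fixes t :: "'a \<Rightarrow> 'b :: comm_ring_1"
  assumes "finite I"
  shows "\<exists>V. (\<Prod>i\<in>I. \<Prod>j\<in>I - {i}. t i - t j) = (-1) ^ (card I choose 2) * V\<^sup>2"
  using assms
proof induction
  case empty
  show ?case by (intro exI[of _ 1]) (simp add: numeral_2_eq_2)
next
  case (insert x F)
  then obtain V where V: "(\<Prod>i\<in>F. \<Prod>j\<in>F - {i}. t i - t j) = (-1) ^ (card F choose 2) * V\<^sup>2"
    by blast
  define U where "U = (\<Prod>j\<in>F. t x - t j)"
  have "(\<Prod>j\<in>insert x F - {i}. t i - t j) = (- 1) * (t x - t i) * (\<Prod>j\<in>F - {i}. t i - t j)"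
    if "i \<in> F" for i
  proof -
    have "insert x F - {i} = insert x (F - {i})" using that insert.hyps by auto
    then show ?thesis using insert.hyps by simp
  qed
  then have "(\<Prod>i\<in>F. \<Prod>j\<in>insert x F - {i}. t i - t j) =
      (-1) ^ card F * U * (\<Prod>i\<in>F. \<Prod>j\<in>F - {i}. t i - t j)"
    by (simp add: prod.distrib U_def del: mult_minus1 mult_minus_left)
  moreover have "insert x F - {x} = F" using insert.hyps by auto
  ultimately have "(\<Prod>i\<in>insert x F. \<Prod>j\<in>insert x F - {i}. t i - t j) =
      U * ((-1) ^ card F * U * ((-1) ^ (card F choose 2) * V\<^sup>2))"
    using insert.hyps V by (simp add: U_def)
  also have "\<dots> = (-1) ^ (card (insert x F) choose 2) * (U * V)\<^sup>2"
    using insert.hyps by (simp add: numeral_2_eq_2 power_add power_mult_distrib algebra_simps)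
  finally show ?case by blast
qed

text \<open>If all \<open>t\<^sub>i\<close> are distinct, the moment conditions force \<open>c\<^sub>i\<close> to be proportional to
  \<open>1 / \<Prod>\<^bsub>j \<noteq> i\<^esub> (t\<^sub>i - t\<^sub>j)\<close>, so that up to sign \<open>\<Prod> c\<^sub>i\<close> is a square modulo \<open>p\<close>.\<close>

lemma dvd_level_sum_of_moments:
  fixes t c :: "'a \<Rightarrow> int"
  assumes p: "prime p" "2 < p" and "finite I" "even (card I)" "card I \<ge> 2"
    and inj: "\<And>i k. i \<in> I \<Longrightarrow> k \<in> I \<Longrightarrow> int p dvd t i - t k \<Longrightarrow> t i = t k"
    and mom: "\<And>j. j \<le> card I - 2 \<Longrightarrow> int p dvd (\<Sum>i\<in>I. c i * t i ^ j)"
    and nonres: "Legendre ((-1) ^ (card I div 2) * (\<Prod>i\<in>I. c i)) (int p) = -1"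
  shows "int p dvd (\<Sum>i\<in>{i\<in>I. t i = v}. c i)"
proof (cases "inj_on t I")
  case False
  have "card (t ` I) < card I"
    using False assms(3) card_image_le[OF assms(3), of t] eq_card_imp_inj_on[OF assms(3), of t]
    by linarith
  then have "card (t ` I) \<le> Suc (card I - 2)" by simp
  then show ?thesis
    using dvd_level_sum_of_few_values[OF _ assms(3) inj mom] p(1) by simp
next
  case True
  obtain h where h: "card I = 2 * h" using assms(4) by auto
  define P where "P i = (\<Prod>j\<in>I - {i}. t i - t j)" for i
  obtain V where V: "(\<Prod>i\<in>I. P i) = (-1) ^ (card I choose 2) * V\<^sup>2"
    using prod_differences_eq_square[OF assms(3), of t] unfolding P_def by blast
  \<comment> \<open>The factor \<open>2 * h - 1\<close> is odd, so the sign is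
    \<open>(-1) ^ h\<close>, exactly the sign attached to the product of the coefficients.\<close>
  have "card I choose 2 = h * (2 * h - 1)"
    unfolding choose_two h by simp
  moreover have "h > 0" using h assms(5) by simp
  then have "odd (2 * h - 1)" by simp
  ultimately have sgn: "(-1 :: int) ^ (card I choose 2) = (-1) ^ h" by (simp add: uminus_power_if)
  have "\<not> int p dvd P i" if "i \<in> I" for i
  proof
    assume "int p dvd P i"
    then obtain j where "j \<in> I" "j \<noteq> i" "int p dvd t i - t j"
      using p(1) assms(3) by (auto simp: P_def prime_dvd_prod_iff)
    then show False using inj[OF that] True that by (auto dest: inj_onD)
  qed
  then have "\<not> int p dvd (\<Prod>i\<in>I. P i)" using p(1) assms(3) by (simp add: prime_dvd_prod_iff)
  then have nV: "\<not> int p dvd V" unfolding V by (auto simp: power2_eq_square)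
  obtain k where k: "k \<in> I" using assms(5) by fastforce
  \<comment> \<open>All \<open>c i * P i\<close> agree with \<open>y\<close> modulo
    \<open>p\<close>, and there are \<open>2 * h\<close> of them, so their product is congruent to
    the square of \<open>y ^ h\<close>. A square never has symbol -1, whence the
    contradiction.\<close>
  define y where "y = c k * P k"
  have "[(\<Prod>i\<in>I. c i * P i) = (\<Prod>i\<in>I. y)] (mod int p)"
  proof (rule cong_prod)
    fix i assume "i \<in> I"
    then show "[c i * P i = y] (mod int p)"
      using dvd_diff_of_distinct_values[OF assms(3) True _ mom, of "card I - 2" i k] k
      unfolding y_def P_def cong_iff_dvd_diff by simp
  qed
  also have "(\<Prod>i\<in>I. c i * P i) = ((-1) ^ (card I div 2) * (\<Prod>i\<in>I. c i)) * V\<^sup>2"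
    using sgn V h by (simp add: prod.distrib)
  also have "(\<Prod>i\<in>I. y) = (y ^ h)\<^sup>2" by (simp add: h power_mult mult.commute flip: power_mult)
  finally have "Legendre (((-1) ^ (card I div 2) * (\<Prod>i\<in>I. c i)) * V\<^sup>2) (int p)
      = Legendre ((y ^ h)\<^sup>2) (int p)"
    by (rule Legendre_cong)
  then have "Legendre ((y ^ h)\<^sup>2) (int p) = -1"
    using Legendre_mult[OF p] Legendre_square[OF p(1) nV] nonres by simp
  then show ?thesis
    by (metis QuadRes_def Legendre_def cong_refl one_neq_neg_one zero_neq_neg_one)
qed

section \<open>Zero-sum partitions\<close>

text \<open>For the least zero-sum partition this characterises the trivial solutions. Unlike
  vanishing level sums, it visibly survives applying a function to all coordinates and combining
  digits.\<close>

definition block_const :: "nat set set \<Rightarrow> (nat \<Rightarrow> 'a) \<Rightarrow> bool" where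
  "block_const P x \<longleftrightarrow> (\<forall>B\<in>P. \<forall>i\<in>B. \<forall>j\<in>B. x i = x j)"

lemma block_const_comp: "block_const P x \<Longrightarrow> block_const P (\<lambda>i. f (x i))"
  unfolding block_const_def by metis

lemma block_const_level_partition:
  assumes "refines {1..s} P (level_partition s x)"
  shows "block_const P x"
  unfolding block_const_def
proof (intro ballI)
  fix B i j assume B: "B \<in> P" "i \<in> B" "j \<in> B"
  then obtain k where "B \<subseteq> {j \<in> {1..s}. x j = x k}"
    using assms unfolding refines_def level_partition_def by blast
  then have "x i = x k" "x j = x k" using B by blast+
  then show "x i = x j" by simp
qed

lemma sum_block_const_eq_0:
  assumes "partition_on {1..s} P" "zero_sum_blocks c P" "block_const P g"
  shows "(\<Sum>i=1..s. c i * g i) = 0"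
proof -
  have U: "{1..s} = \<Union>P" using assms(1) by (simp add: partition_on_def)
  have "(\<Sum>i\<in>\<Union>P. c i * g i) = (\<Sum>B\<in>P. \<Sum>i\<in>B. c i * g i)"
  proof (subst sum.Union_disjoint)
    show "\<forall>B\<in>P. finite B" using U by (metis Union_upper finite_atLeastAtMost finite_subset)
    show "\<forall>A\<in>P. \<forall>B\<in>P. A \<noteq> B \<longrightarrow> A \<inter> B = {}"
      using assms(1) by (auto simp: partition_on_def disjoint_def)
  qed simp
  also have "\<dots> = (\<Sum>B\<in>P. 0)"
  proof (rule sum.cong[OF refl])
    fix B assume B: "B \<in> P"
    then have "B \<noteq> {}" using assms(1) by (auto simp: partition_on_def)
    then obtain b where b: "b \<in> B" by blast
    have "(\<Sum>i\<in>B. c i * g i) = (\<Sum>i\<in>B. c i * g b)"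
      using assms(3) B b by (intro sum.cong refl) (metis block_const_def)
    also have "\<dots> = 0" using assms(2) B by (simp add: zero_sum_blocks_def flip: sum_distrib_right)
    finally show "(\<Sum>i\<in>B. c i * g i) = 0" .
  qed
  finally show ?thesis unfolding U by simp
qed

lemma trivial_solution_if_block_const:
  assumes "partition_on {1..s} P" "zero_sum_blocks c P" "block_const P x"
  shows "trivial_solution s c x"
  unfolding trivial_solution_def
proof
  show "lin_form s c x = 0"
    unfolding lin_form_def by (rule sum_block_const_eq_0[OF assms])
  show "zero_sum_blocks c (level_partition s x)"
    unfolding zero_sum_blocks_def
  proof
    fix T assume "T \<in> level_partition s x"
    then obtain k where T: "T = {j \<in> {1..s}. x j = x k}" by (auto simp: level_partition_def)
    \<comment> \<open>The indicator of a level set is a function of \<open>x\<close>, hence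
      block-constant, and its weighted sum is the level sum.\<close>
    have "(\<Sum>i=1..s. c i * of_bool (x i = x k)) = 0"
      by (rule sum_block_const_eq_0[OF assms(1,2)]) (rule block_const_comp[OF assms(3)])
    also have "(\<Sum>i=1..s. c i * of_bool (x i = x k)) = (\<Sum>i\<in>T. c i)"
      unfolding T by (rule sum.mono_neutral_cong_right) auto
    finally show "(\<Sum>i\<in>T. c i) = 0" .
  qed
qed

text \<open>Among the refinements of \<open>Q\<close> satisfying \<Phi>, take one whose equivalence
  relation \<open>E R\<close> has the fewest pairs; a proper refinement would have fewer.\<close>

lemma exists_minimal_refinement:
  assumes "finite A" "partition_on A Q" "\<Phi> Q"
  obtains R where "partition_on A R" "\<Phi> R" "refines A R Q"
    "\<And>R'. \<Phi> R' \<Longrightarrow> refines A R' R \<Longrightarrow> R' = R"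
proof -
  define E where "E R = (\<Union>T\<in>R. T \<times> T)" for R :: "'a set set"
  let ?X = "\<lambda>R. \<Phi> R \<and> refines A R Q"
  have "?X Q" using assms refines_refl by auto
  then obtain R where R: "?X R" "\<And>R'. ?X R' \<Longrightarrow> card (E R) \<le> card (E R')"
    using ex_has_least_nat[of ?X Q "\<lambda>R. card (E R)"] by blast
  have "R' = R" if R': "\<Phi> R'" "refines A R' R" for R'
  proof (rule refines_asym[OF R'(2)])
    have p: "partition_on A R" "partition_on A R'" using R'(2) by (auto simp: refines_def)
    have "?X R'" using R' R(1) refines_trans by blast
    then have "card (E R) \<le> card (E R')" by (rule R(2))
    moreover have "E R' \<subseteq> E R" using R'(2) unfolding refines_def E_def by blast
    moreover have "E R \<subseteq> A \<times> A" using p by (auto simp: partition_on_def E_def)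
    then have "finite (E R)" using assms(1) finite_subset by blast
    ultimately have E: "E R = E R'" by (metis card_seteq)
    show "refines A R R'"
      unfolding refines_def
    proof (intro conjI p ballI)
      fix T assume T: "T \<in> R"
      then have "T \<noteq> {}" using p(1) by (auto simp: partition_on_def)
      then obtain x where x: "x \<in> T" by blast
      then have "x \<in> A" using T p(1) by (auto simp: partition_on_def)
      then obtain Y where Y: "Y \<in> R'" "x \<in> Y" using p(2) by (auto simp: partition_on_def)
      have "T \<subseteq> Y"
      proof
        fix z assume "z \<in> T"
        then have "(x, z) \<in> E R'" using x T E by (auto simp: E_def)
        then obtain Y' where "Y' \<in> R'" "x \<in> Y'" "z \<in> Y'" by (auto simp: E_def)
        then show "z \<in> Y" using Y p(2) by (auto simp: partition_on_def disjoint_def)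
      qed
      then show "\<exists>Y\<in>R'. T \<subseteq> Y" using Y by blast
    qed
  qed
  then show ?thesis using that R(1) by (auto simp: refines_def)
qed

text \<open>Every zero-sum partition has a minimal zero-sum refinement, and uniqueness identifies it
  with \<open>P\<close>. So the unique minimal partition is a least one.\<close>

lemma primitive_form_refines:
  assumes "primitive_form s c"
  obtains P where "partition_on {1..s} P" "zero_sum_blocks c P"
    "\<And>Q. partition_on {1..s} Q \<Longrightarrow> zero_sum_blocks c Q \<Longrightarrow> refines {1..s} P Q"
proof -
  obtain P where P: "finest_zero_sum_partition s c P"
    "\<And>P'. finest_zero_sum_partition s c P' \<Longrightarrow> P' = P"
    using assms unfolding primitive_form_def by blast
  have "refines {1..s} P Q" if Q: "partition_on {1..s} Q" "zero_sum_blocks c Q" for Q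
  proof -
    obtain R where R: "partition_on {1..s} R" "zero_sum_blocks c R" "refines {1..s} R Q"
      "\<And>R'. zero_sum_blocks c R' \<Longrightarrow> refines {1..s} R' R \<Longrightarrow> R' = R"
      using exists_minimal_refinement[where \<Phi> = "zero_sum_blocks c", OF _ Q] by auto
    then have "finest_zero_sum_partition s c R" by (auto simp: finest_zero_sum_partition_def)
    then show ?thesis using P(2) R(3) by blast
  qed
  then show ?thesis using that P(1) by (auto simp: finest_zero_sum_partition_def)
qed

section \<open>Digitwise lifting\<close>

text \<open>The \<open>j\<close>-th coordinate of the moment curve, taken on each of the lowest
  \<open>k\<close> base-\<open>p\<close> digits. Reducing each power modulo \<open>p\<close> makes
  it a digit again, so the size bound \<open>p ^ k\<close> does not grow with
  \<open>j\<close>.\<close>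

primrec digit_power :: "nat \<Rightarrow> nat \<Rightarrow> nat \<Rightarrow> nat \<Rightarrow> nat" where
  "digit_power p j 0 t = 0"
| "digit_power p j (Suc k) t = (t mod p) ^ j mod p + p * digit_power p j k (t div p)"

lemma digit_power_less: "p > 0 \<Longrightarrow> digit_power p j k t < p ^ k"
proof (induction k arbitrary: t)
  case (Suc k)
  have "Suc (digit_power p j k (t div p)) \<le> p ^ k" using Suc by (simp add: Suc_leI)
  then have "p * Suc (digit_power p j k (t div p)) \<le> p * p ^ k" by (rule mult_le_mono2)
  moreover have "(t mod p) ^ j mod p < p" using Suc.prems by simp
  ultimately show ?case by simp
qed simp

lemma digit_power_1: "digit_power p 1 k t = t mod p ^ k"
  by (induction k arbitrary: t) (simp_all add: mod_mult2_eq)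

text \<open>Induction from the lowest digit: \<open>step\<close> is the one-digit statement modulo
  \<open>p\<close>, and \<open>zero\<close> removes that digit so that the hypotheses pass to
  \<open>t i div p\<close>.\<close>

lemma block_const_mod_of_digit_power_sums:
  fixes c :: "nat \<Rightarrow> int" and t :: "nat \<Rightarrow> nat"
  assumes p: "p > 0"
    and step: "\<And>r. (\<And>i. r i < p) \<Longrightarrow>
      (\<And>j. j \<in> {1..d} \<Longrightarrow> int p dvd (\<Sum>i=1..s. c i * int (r i) ^ j)) \<Longrightarrow> block_const P r"
    and zero: "\<And>g. block_const P g \<Longrightarrow> (\<Sum>i=1..s. c i * g i) = 0"
    and sums: "\<And>j. j \<in> {1..d} \<Longrightarrow> (\<Sum>i=1..s. c i * int (digit_power p j k (t i))) = 0"
  shows "block_const P (\<lambda>i. t i mod p ^ k)"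
  using sums
proof (induction k arbitrary: t)
  case 0
  show ?case by (simp add: block_const_def)
next
  case (Suc k)
  define r where "r i = t i mod p" for i
  let ?S = "\<lambda>j. \<Sum>i=1..s. c i * int (r i ^ j mod p)"
  let ?S' = "\<lambda>j. \<Sum>i=1..s. c i * int (digit_power p j k (t i div p))"
  have split: "?S j + int p * ?S' j = 0" if "j \<in> {1..d}" for j
  proof -
    have "?S j + int p * ?S' j = (\<Sum>i=1..s. c i * int (digit_power p j (Suc k) (t i)))"
      by (simp add: sum_distrib_left sum.distrib[symmetric] algebra_simps r_def)
    then show ?thesis using Suc.prems[OF that] by simp
  qed
  have r: "block_const P r"
  proof (rule step)
    show "r i < p" for i using p by (simp add: r_def)
    fix j assume j: "j \<in> {1..d}"
    have "?S j = int p * (- ?S' j)" using split[OF j] by simp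
    then have "int p dvd ?S j" by (rule dvdI)
    moreover have "[?S j = (\<Sum>i=1..s. c i * int (r i) ^ j)] (mod int p)"
      by (intro cong_sum cong_mult cong_refl) (simp add: cong_def zmod_int)
    ultimately show "int p dvd (\<Sum>i=1..s. c i * int (r i) ^ j)" using cong_dvd_iff by blast
  qed
  text \<open>A block-constant lowest digit contributes exactly \<open>0\<close>, so it causes no carry.\<close>
  have "?S' j = 0" if "j \<in> {1..d}" for j
  proof -
    have "?S j = 0" by (rule zero) (rule block_const_comp[OF r])
    then show ?thesis using split[OF that] p by simp
  qed
  then have "block_const P (\<lambda>i. t i div p mod p ^ k)" by (rule Suc.IH)
  moreover have "t i mod p ^ Suc k = p * (t i div p mod p ^ k) + r i" for i
    by (simp add: mod_mult2_eq r_def)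
  ultimately show ?case using r unfolding block_const_def by metis
qed

section \<open>Packing the coordinates into one integer, and the lower bound\<close>

lemma base_expansion_eq_0:
  fixes e :: "nat \<Rightarrow> int"
  assumes "\<And>j. j < d \<Longrightarrow> \<bar>e j\<bar> < B" "(\<Sum>j<d. e j * B ^ j) = 0" "j < d"
  shows "e j = 0"
  using assms
proof (induction d arbitrary: e j)
  case (Suc d)
  have s: "(\<Sum>j<Suc d. e j * B ^ j) = e 0 + B * (\<Sum>j<d. e (Suc j) * B ^ j)"
    by (subst sum.lessThan_Suc_shift) (simp add: sum_distrib_left algebra_simps)
  have "e 0 = B * (- (\<Sum>j<d. e (Suc j) * B ^ j))" using Suc.prems(2) s by simp
  \<comment> \<open>Digits may be negative, but a multiple of \<open>B\<close> smaller than
    \<open>B\<close> in absolute value is 0.\<close>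
  then have "B dvd e 0" by (rule dvdI)
  then have e0: "e 0 = 0" using Suc.prems(1)[of 0] dvd_imp_le_int[of "e 0" B] by linarith
  have "B > 0" using Suc.prems(1)[of 0] by simp
  then have "(\<Sum>j<d. e (Suc j) * B ^ j) = 0" using Suc.prems(2) s e0 by simp
  moreover have "\<bar>e (Suc i)\<bar> < B" if "i < d" for i using Suc.prems(1) that by simp
  ultimately have "e (Suc i) = 0" if "i < d" for i
    using Suc.IH[of "\<lambda>j. e (Suc j)" i] that by blast
  then show ?case using e0 Suc.prems(3) by (cases j) simp_all
qed simp

lemma base_expansion_less:
  fixes a :: "nat \<Rightarrow> int"
  assumes "\<And>j. j < d \<Longrightarrow> 0 \<le> a j \<and> a j < B"
  shows "(\<Sum>j<d. a j * B ^ j) < B ^ d"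
  using assms
proof (induction d)
  case (Suc d)
  have "B > 0" using Suc.prems[of 0] by auto
  have "(\<Sum>j<Suc d. a j * B ^ j) < B ^ d + a d * B ^ d" using Suc by simp
  also have "\<dots> = (a d + 1) * B ^ d" by (simp add: algebra_simps)
  also have "\<dots> \<le> B * B ^ d" using Suc.prems[of d] \<open>B > 0\<close> by (intro mult_right_mono) auto
  finally show ?case by simp
qed simp

lemma r_form_ge_card:
  assumes "A \<subseteq> {1..int N}" "form_free s c A"
  shows "card A \<le> r_form s c N"
  unfolding r_form_def using assms finite_form_free_sets by (intro Max_ge) auto

text \<open>Level sums divisible by \<open>p\<close> vanish over the integers because their absolute
  values are below \<open>p\<close>. Hence the level partition is zero-sum and \<open>P\<close>
  refines it.\<close>

lemma block_const_of_moments: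
  fixes c :: "nat \<Rightarrow> int" and r :: "nat \<Rightarrow> nat"
  assumes p: "prime p" "2 < p" "(\<Sum>i=1..s. \<bar>c i\<bar>) < int p" and s: "even s" "2 \<le> s"
    and "(\<Sum>i=1..s. c i) = 0"
    and nonres: "Legendre ((-1) ^ (s div 2) * (\<Prod>i=1..s. c i)) (int p) = -1"
    and P: "\<And>Q. partition_on {1..s} Q \<Longrightarrow> zero_sum_blocks c Q \<Longrightarrow> refines {1..s} P Q"
    and r: "\<And>i. r i < p"
    and mom: "\<And>j. j \<in> {1..s - 2} \<Longrightarrow> int p dvd (\<Sum>i=1..s. c i * int (r i) ^ j)"
  shows "block_const P r"
proof -
  have "zero_sum_blocks c (level_partition s (\<lambda>i. int (r i)))"
    unfolding zero_sum_blocks_def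
  proof
    fix T assume "T \<in> level_partition s (\<lambda>i. int (r i))"
    then obtain k where T: "T = {i\<in>{1..s}. int (r i) = int (r k)}" by (auto simp: level_partition_def)
    have "int p dvd (\<Sum>i\<in>T. c i)"
      unfolding T
    proof (rule dvd_level_sum_of_moments[OF p(1,2)])
      fix i j assume "int p dvd int (r i) - int (r j)"
      then have "[int (r i) = int (r j)] (mod int p)" by (simp add: cong_iff_dvd_diff)
      then show "int (r i) = int (r j)" using r by (simp add: cong_def)
    next
      \<comment> \<open>The moment \<open>j = 0\<close> is the coefficient sum, supplied by
        translation invariance.\<close>
      fix j assume "j \<le> card {1..s} - 2"
      then show "int p dvd (\<Sum>i\<in>{1..s}. c i * int (r i) ^ j)"
        using mom[of j] assms(6) by (cases "j = 0") auto
    qed (use s nonres in auto)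
    moreover have "\<bar>\<Sum>i\<in>T. c i\<bar> < int p"
    proof -
      have "\<bar>\<Sum>i\<in>T. c i\<bar> \<le> (\<Sum>i\<in>T. \<bar>c i\<bar>)" by (rule sum_abs)
      also have "\<dots> \<le> (\<Sum>i=1..s. \<bar>c i\<bar>)" by (rule sum_mono2) (auto simp: T)
      finally show ?thesis using p(3) by simp
    qed
    ultimately show "(\<Sum>i\<in>T. c i) = 0" using dvd_imp_le_int[of "\<Sum>i\<in>T. c i" "int p"] by auto
  qed
  then have "block_const P (\<lambda>i. int (r i))"
    by (intro block_const_level_partition[of s] P partition_on_level_partition)
  then show ?thesis unfolding block_const_def of_nat_eq_iff .
qed

lemma exists_form_free_set:
  fixes c :: "nat \<Rightarrow> int"
  assumes p: "prime p" "2 < p" "(\<Sum>i=1..s. \<bar>c i\<bar>) < int p" and s: "even s" "3 \<le> s"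
    and c0: "(\<Sum>i=1..s. c i) = 0"
    and nonres: "Legendre ((-1) ^ (s div 2) * (\<Prod>i=1..s. c i)) (int p) = -1"
    and prim: "primitive_form s c"
    and N: "((\<Sum>i=1..s. \<bar>c i\<bar>) + 1) * int p ^ k = B" "B ^ (s - 2) \<le> int N"
  obtains A where "A \<subseteq> {1..int N}" "form_free s c A" "card A = p ^ k"
proof -
  obtain P where P: "partition_on {1..s} P" "zero_sum_blocks c P"
    "\<And>Q. partition_on {1..s} Q \<Longrightarrow> zero_sum_blocks c Q \<Longrightarrow> refines {1..s} P Q"
    using primitive_form_refines[OF prim] by blast
  define d where "d = s - 2"
  \<comment> \<open>The index is shifted so that the exponents run from 1 to
    \<open>s - 2\<close>.\<close>
  define v where "v t j = int (digit_power p (Suc j) k t)" for t j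
  define F where "F t = (\<Sum>j<d. v t j * B ^ j)" for t
  \<comment> \<open>\<open>F\<close> can be 0; adding 1 places the set inside
    \<open>{1..int N}\<close>, and the zero coefficient sum cancels the shift.\<close>
  define A where "A = (\<lambda>t. 1 + F t) ` {..<p ^ k}"
  have p0: "p > 0" using p(2) by simp
  have csum: "(\<Sum>i=1..s. \<bar>c i\<bar>) \<ge> 0" by (simp add: sum_nonneg)
  have pkB: "int p ^ k \<le> B"
    using mult_right_mono[of 1 "(\<Sum>i=1..s. \<bar>c i\<bar>) + 1" "int p ^ k"] csum N(1) by simp
  have v: "0 \<le> v t j" "v t j < int p ^ k" for t j
    using digit_power_less[OF p0, of "Suc j" k t] by (auto simp: v_def simp flip: of_nat_power)
  have "form_free s c A"
    unfolding form_free_def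
  proof (intro ballI impI)
    fix x assume x: "x \<in> {1..s} \<rightarrow> A" and L: "lin_form s c x = 0"
    then have "\<forall>i\<in>{1..s}. \<exists>t. t < p ^ k \<and> x i = 1 + F t" by (fastforce simp: A_def)
    then obtain t where t: "\<And>i. i \<in> {1..s} \<Longrightarrow> t i < p ^ k \<and> x i = 1 + F (t i)" by metis
    define e where "e j = (\<Sum>i=1..s. c i * v (t i) j)" for j
    have "0 = (\<Sum>i=1..s. c i * (1 + F (t i)))"
      using L t unfolding lin_form_def by (metis (no_types, lifting) sum.cong)
    also have "\<dots> = (\<Sum>i=1..s. c i * F (t i))"
      using c0 by (simp add: algebra_simps sum.distrib)
    also have "\<dots> = (\<Sum>i=1..s. \<Sum>j<d. c i * v (t i) j * B ^ j)"
      by (simp add: F_def sum_distrib_left algebra_simps)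
    also have "\<dots> = (\<Sum>j<d. e j * B ^ j)"
      by (subst sum.swap) (simp add: e_def sum_distrib_right)
    finally have eq: "(\<Sum>j<d. e j * B ^ j) = 0" by simp
    \<comment> \<open>The summand 1 in the definition of \<open>B\<close> makes this strict, so the
      coordinates separate in base \<open>B\<close>.\<close>
    have "\<bar>e j\<bar> < B" for j
    proof -
      have "\<bar>e j\<bar> \<le> (\<Sum>i=1..s. \<bar>c i * v (t i) j\<bar>)" unfolding e_def by (rule sum_abs)
      also have "\<dots> \<le> (\<Sum>i=1..s. \<bar>c i\<bar> * int p ^ k)"
      proof (rule sum_mono)
        fix i
        have "\<bar>v (t i) j\<bar> \<le> int p ^ k" using v[of "t i" j] by simp
        then show "\<bar>c i * v (t i) j\<bar> \<le> \<bar>c i\<bar> * int p ^ k"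
          unfolding abs_mult by (rule mult_left_mono) simp
      qed
      also have "\<dots> < B" using p0 by (simp add: sum_distrib_right[symmetric] algebra_simps flip: N(1))
      finally show ?thesis .
    qed
    then have e: "e j = 0" if "j < d" for j using base_expansion_eq_0[OF _ eq that] by blast
    have "block_const P (\<lambda>i. t i mod p ^ k)"
    proof (rule block_const_mod_of_digit_power_sums[where d = d and c = c and s = s, OF p0])
      fix r :: "nat \<Rightarrow> nat"
      assume "\<And>i. r i < p" "\<And>j. j \<in> {1..d} \<Longrightarrow> int p dvd (\<Sum>i=1..s. c i * int (r i) ^ j)"
      then show "block_const P r"
        using s by (intro block_const_of_moments[OF p s(1) _ c0 nonres P(3)]) (auto simp: d_def)
    next
      fix g :: "nat \<Rightarrow> int" assume "block_const P g"
      then show "(\<Sum>i=1..s. c i * g i) = 0" by (rule sum_block_const_eq_0[OF P(1,2)])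
    next
      fix j assume "j \<in> {1..d}"
      then show "(\<Sum>i=1..s. c i * int (digit_power p j k (t i))) = 0"
        using e[of "j - 1"] by (auto simp: e_def v_def)
    qed
    then have "block_const P (\<lambda>i. 1 + F (t i mod p ^ k))" by (rule block_const_comp)
    moreover have "x i = 1 + F (t i mod p ^ k)" if "B \<in> P" "i \<in> B" for B i
    proof -
      have "i \<in> {1..s}" using that P(1) by (auto simp: partition_on_def)
      then show ?thesis using t by simp
    qed
    ultimately have "block_const P x" unfolding block_const_def by metis
    then show "trivial_solution s c x" by (rule trivial_solution_if_block_const[OF P(1,2)])
  qed
  moreover have "A \<subseteq> {1..int N}"
  proof
    fix y assume "y \<in> A"
    then obtain t where t: "y = 1 + F t" by (auto simp: A_def)
    have "0 \<le> B" using pkB by (meson order_trans of_nat_0_le_iff zero_le_power)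
    then have "0 \<le> F t" unfolding F_def using v by (intro sum_nonneg mult_nonneg_nonneg) auto
    moreover have "F t < B ^ d"
      unfolding F_def
    proof (intro base_expansion_less conjI)
      show "0 \<le> v t j" "v t j < B" for j using v[of t j] pkB by linarith+
    qed
    ultimately show "y \<in> {1..int N}" using t N(2) by (simp add: d_def)
  qed
  moreover have "inj_on (\<lambda>t. 1 + F t) {..<p ^ k}"
  proof (rule inj_onI)
    fix t u assume tu: "t \<in> {..<p ^ k}" "u \<in> {..<p ^ k}" "1 + F t = 1 + F u"
    have "(\<Sum>j<d. (v t j - v u j) * B ^ j) = 0"
      using tu(3) by (simp add: F_def left_diff_distrib sum_subtractf)
    moreover have "\<bar>v t j - v u j\<bar> < B" for j using v[of t j] v[of u j] pkB by linarith
    moreover have "0 < d" using s by (simp add: d_def)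
    \<comment> \<open>Coordinate 0 is the first power, which returns \<open>t\<close> itself below
      \<open>p ^ k\<close>.\<close>
    ultimately have "v t 0 - v u 0 = 0" using base_expansion_eq_0[of d "\<lambda>j. v t j - v u j" B 0] by blast
    then show "t = u" using tu(1,2) digit_power_1[of p k] by (simp add: v_def)
  qed
  then have "card A = p ^ k" by (simp add: A_def card_image)
  ultimately show ?thesis using that by blast
qed

lemma form_free_singleton:
  assumes "(\<Sum>i=1..s. c i) = 0"
  shows "form_free s c {a}"
  unfolding form_free_def
proof (intro ballI impI)
  fix x assume x: "x \<in> {1..s} \<rightarrow> {a}" and L: "lin_form s c x = 0"
  have xa: "x i = a" if "i \<in> {1..s}" for i using x that by auto
  have "T = {1..s}" if T: "T \<in> level_partition s x" for T
  proof -
    obtain i where "i \<in> {1..s}" "T = {j \<in> {1..s}. x j = x i}"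
      using T unfolding level_partition_def by blast
    then show ?thesis using xa[of i] xa by blast
  qed
  then show "trivial_solution s c x"
    using L assms by (auto simp: trivial_solution_def zero_sum_blocks_def)
qed

theorem theorem4:
  fixes s :: nat and c :: "nat \<Rightarrow> int"
  assumes "s \<ge> 3" and "even s"
    and "translation_invariant s c"
    and "primitive_form s c"
    and "\<not> is_square ((-1) ^ (s div 2) * (\<Prod>i=1..s. c i))"
  shows "\<exists>C>0. \<forall>N\<ge>1. real (r_form s c N) \<ge> C * real N powr (1 / (real s - 2))"
proof -
  have c0: "(\<Sum>i=1..s. c i) = 0" using assms(3) by (simp add: translation_invariant_def)
  define K where "K = nat (\<Sum>i=1..s. \<bar>c i\<bar>) + 1"
  have K: "int K = (\<Sum>i=1..s. \<bar>c i\<bar>) + 1" by (simp add: K_def sum_nonneg)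
  obtain p where p: "prime p" "p > K + 2"
    "Legendre ((-1) ^ (s div 2) * (\<Prod>i=1..s. c i)) (int p) = -1"
    using exists_prime_nonresidue[OF assms(5)] by blast
  have p1: "2 < p" "(\<Sum>i=1..s. \<bar>c i\<bar>) < int p" using p(2) K by auto
  define d where "d = s - 2"
  have d: "d > 0" "real s - 2 = real d" using assms(1) by (auto simp: d_def)
  \<comment> \<open>\<open>K\<close> comes from the packing base; \<open>p\<close> is the loss
    between consecutive admissible powers of \<open>p\<close>.\<close>
  define C where "C = 1 / (real K * real p)"
  have "K > 0" by (simp add: K_def)
  then have C0: "C > 0" using p1 by (simp add: C_def)
  have root: "real N powr (1 / real d) \<le> X" if "real N \<le> X ^ d" "X > 0" for N X
  proof -
    have "real N powr (1 / real d) \<le> (X ^ d) powr (1 / real d)"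
      using that by (intro powr_mono2) auto
    also have "\<dots> = X" using that d(1) by (simp add: powr_powr flip: powr_realpow)
    finally show ?thesis .
  qed
  have "C * real N powr (1 / (real s - 2)) \<le> real (r_form s c N)" if "N \<ge> 1" for N
  proof -
    let ?big = "\<lambda>k. N < (K * p ^ k) ^ d"
    have "\<exists>k. ?big k"
    proof
      have "N < 2 ^ N" by simp
      also have "\<dots> \<le> p ^ N" using p1 by (intro power_mono) auto
      also have "\<dots> \<le> K * p ^ N" using \<open>K > 0\<close> by simp
      also have "\<dots> \<le> (K * p ^ N) ^ d" using d(1) \<open>K > 0\<close> p1 by (intro self_le_power) auto
      finally show "?big N" .
    qed
    \<comment> \<open>With \<open>m\<close> least, \<open>m - 1\<close> still fits into
      \<open>N\<close> when \<open>m > 0\<close>, while \<open>m\<close> bounds the root of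
      \<open>N\<close> from above. For \<open>m = 0\<close> that root is at most \<open>K\<close>,
      and a singleton suffices.\<close>
    then obtain m where m: "?big m" "\<And>k. k < m \<Longrightarrow> \<not> ?big k"
      using exists_least_iff[of ?big] by blast
    have "real N \<le> (real K * real p ^ m) ^ d"
      using m(1) of_nat_le_iff[of N "(K * p ^ m) ^ d", where 'a = real] by simp
    then have up: "real N powr (1 / real d) \<le> real K * real p ^ m"
      using \<open>K > 0\<close> p1 by (intro root) auto
    show ?thesis
    proof (cases m)
      case 0
      have "card {1 :: int} \<le> r_form s c N"
        using that by (intro r_form_ge_card form_free_singleton c0) auto
      then have "1 \<le> real (r_form s c N)" by simp
      moreover have "C * real N powr (1 / real d) \<le> C * real K"
        using up C0 0 by (intro mult_left_mono) auto
      moreover have "C * real K \<le> 1" using \<open>K > 0\<close> p1 by (simp add: C_def)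
      ultimately show ?thesis using d(2) by simp
    next
      case (Suc k)
      have "(K * p ^ k) ^ d \<le> N" using m(2)[of k] Suc by simp
      then have "(int K * int p ^ k) ^ d \<le> int N"
        by (metis of_nat_le_iff of_nat_mult of_nat_power)
      then obtain A where "A \<subseteq> {1..int N}" "form_free s c A" "card A = p ^ k"
        using exists_form_free_set[OF p(1) p1 assms(2,1) c0 p(3) assms(4) refl, of k N]
        unfolding K d_def by blast
      then have "p ^ k \<le> r_form s c N" using r_form_ge_card by metis
      then have "real p ^ k \<le> real (r_form s c N)"
        by (metis of_nat_le_iff of_nat_power)
      moreover have "C * real N powr (1 / real d) \<le> C * (real K * real p ^ m)"
        using up C0 by (intro mult_left_mono) auto
      moreover have "C * (real K * real p ^ m) = real p ^ k"
        using \<open>K > 0\<close> p1 by (simp add: C_def Suc)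
      ultimately show ?thesis unfolding d(2) by linarith
    qed
  qed
  with C0 show ?thesis by blast
qed

end
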